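(* Up to isomorphism, the countable polymorphism homogeneous disconnected oriented graphs are exactly $k\cdot I_1$ and $k\cdot C_3$, for $1<k\le\omega$.
   Context: An oriented graph is a pair $\Gamma=(V,E)$ with $V$ a non-empty set and $E\subseteq V^2$ an asymmetric relation; write $x\sim y$ if $(x,y)\in E$ or $(y,x)\in E$. Weakly connected components are the classes of "joined by a finite sequence $x=z_0\sim\dots\sim z_k=y$"; disconnected means more than one component. Countable means finite or countably infinite. $I_1$ is the one-vertex graph with no arcs; $C_3$ is the directed 3-cycle; $k\cdot\Delta$ denotes the disjoint union of $k$ copies of $\Delta$ with no arcs between copies; $\omega$ is the first infinite cardinal. A homomorphism is an arc-preserving map; an oriented graph is homomorphism homogeneous if every homomorphism between finite induced subgraphs extends to an endomorphism. The $n$-th direct power $\Gamma^n$ has vertex set $V^n$ and arcs $((v_i)_i,(w_i)_i)$ with $(v_i,w_i)\in E$ for all $i$; $\Gamma$ is polymorphism homogeneous if $\Gamma^n$ is homomorphism homogeneous for all $n\ge1$. *)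

theory Defs
  imports
    "Graph_Theory.Graph_Theory"
    "HOL-Library.FuncSet"
    "HOL-Library.Countable_Set"
    "HOL-Library.Extended_Nat"
begin

locale oriented_graph = pair_wf_digraph G for G :: "'a pair_pre_digraph" +
  assumes verts_nonempty: "pverts G \<noteq> {}"
    and asym_arcs: "asym (parcs G)"

(* Reachability in mk_symmetric G is the existence of a finite sequence
   x = z_0 ~ ... ~ z_k = y; it is an equivalence relation on pverts G. *)
definition weak_components :: "'a pair_pre_digraph \<Rightarrow> 'a set set" where
  "weak_components G = pverts G // {(x, y). x \<rightarrow>\<^sup>*\<^bsub>with_proj (mk_symmetric (with_proj G))\<^esub> y}"

definition disconnected :: "'a pair_pre_digraph \<Rightarrow> bool" where
  "disconnected G \<longleftrightarrow> (\<exists>C \<in> weak_components G. \<exists>D \<in> weak_components G. C \<noteq> D)"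

definition digraph_hom ::
    "'a pair_pre_digraph \<Rightarrow> 'b pair_pre_digraph \<Rightarrow> ('a \<Rightarrow> 'b) \<Rightarrow> bool" where
  "digraph_hom G H f \<longleftrightarrow>
     f \<in> pverts G \<rightarrow> pverts H \<and> (\<forall>(x, y) \<in> parcs G. (f x, f y) \<in> parcs H)"

(* Subgraphs are required to be non-empty because oriented graphs are. *)
definition finite_induced_subgraph :: "'a pair_pre_digraph \<Rightarrow> 'a pair_pre_digraph \<Rightarrow> bool" where
  "finite_induced_subgraph A G \<longleftrightarrow>
     induced_subgraph (with_proj A) (with_proj G) \<and> finite (pverts A) \<and> pverts A \<noteq> {}"

definition homomorphism_homogeneous :: "'a pair_pre_digraph \<Rightarrow> bool" where
  "homomorphism_homogeneous G \<longleftrightarrow>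
     (\<forall>A B f. finite_induced_subgraph A G \<and> finite_induced_subgraph B G \<and> digraph_hom A B f
        \<longrightarrow> (\<exists>g. digraph_hom G G g \<and> (\<forall>x \<in> pverts A. g x = f x)))"

definition direct_power :: "nat \<Rightarrow> 'a pair_pre_digraph \<Rightarrow> (nat \<Rightarrow> 'a) pair_pre_digraph" where
  "direct_power n G =
     \<lparr> pverts = {..<n} \<rightarrow>\<^sub>E pverts G,
       parcs = {(v, w). v \<in> {..<n} \<rightarrow>\<^sub>E pverts G \<and> w \<in> {..<n} \<rightarrow>\<^sub>E pverts G \<and>
                        (\<forall>i<n. (v i, w i) \<in> parcs G)} \<rparr>"

definition polymorphism_homogeneous :: "'a pair_pre_digraph \<Rightarrow> bool" where
  "polymorphism_homogeneous G \<longleftrightarrow> (\<forall>n\<ge>1. homomorphism_homogeneous (direct_power n G))"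

(* enat serves as the set of cardinals up to omega, with \<infinity> in the role of omega;
   the copies are indexed by the natural numbers below k. *)
definition copies :: "enat \<Rightarrow> 'a pair_pre_digraph \<Rightarrow> (nat \<times> 'a) pair_pre_digraph" where
  "copies k G =
     \<lparr> pverts = {i. enat i < k} \<times> pverts G,
       parcs = {((i, x), (i, y)) | i x y. enat i < k \<and> (x, y) \<in> parcs G} \<rparr>"

definition I1 :: "nat pair_pre_digraph" where
  "I1 = \<lparr> pverts = {0}, parcs = {} \<rparr>"

definition C3 :: "nat pair_pre_digraph" where
  "C3 = \<lparr> pverts = {0, 1, 2}, parcs = {(0, 1), (1, 2), (2, 0)} \<rparr>"

lemma oriented_graph_I1: "oriented_graph I1"
  by unfold_locales (auto simp: I1_def)

lemma oriented_graph_C3: "oriented_graph C3"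
  by unfold_locales (auto simp: C3_def asym_on_def)

lemma oriented_graph_copies:
  assumes "oriented_graph G" "0 < k"
  shows "oriented_graph (copies k G)"
proof -
  interpret oriented_graph G by fact
  have "enat 0 < k" using \<open>0 < k\<close> by (simp add: zero_enat_def)
  then show ?thesis using verts_nonempty asymD[OF asym_arcs]
    by unfold_locales (auto simp: copies_def intro!: asymI dest: in_arcsD1 in_arcsD2)
qed

lemma oriented_graph_direct_power:
  assumes "oriented_graph G" "1 \<le> n"
  shows "oriented_graph (direct_power n G)"
proof -
  interpret oriented_graph G by fact
  have asymD: "(x, y) \<in> parcs G \<Longrightarrow> (y, x) \<notin> parcs G" for x y
    using asym_arcs by (rule asymD)
  show ?thesis
  proof unfold_locales
    show "pverts (direct_power n G) \<noteq> {}"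
      using verts_nonempty by (simp add: direct_power_def PiE_eq_empty_iff)
    show "asym (parcs (direct_power n G))"
    proof (rule asymI)
      fix v w assume "(v, w) \<in> parcs (direct_power n G)"
      then have "(v 0, w 0) \<in> parcs G" using \<open>1 \<le> n\<close> by (simp add: direct_power_def)
      then show "(w, v) \<notin> parcs (direct_power n G)"
        using asymD \<open>1 \<le> n\<close> by (force simp: direct_power_def)
    qed
  qed (simp_all add: direct_power_def split_beta)
qed

lemma equiv_weakly_connected:
  assumes "oriented_graph G"
  shows "equiv (pverts G) {(x, y). x \<rightarrow>\<^sup>*\<^bsub>with_proj (mk_symmetric (with_proj G))\<^esub> y}"
proof -
  interpret oriented_graph G by fact
  let ?S = "with_proj (mk_symmetric (with_proj G))"
  interpret S: pair_wf_digraph "mk_symmetric (with_proj G)" by (rule wellformed_mk_symmetric)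
  have sym: "symmetric ?S" by (rule symmetric_mk_symmetric)
  show ?thesis
  proof (rule equivI)
    show "{(x, y). x \<rightarrow>\<^sup>*\<^bsub>?S\<^esub> y} \<subseteq> pverts G \<times> pverts G"
      using S.reachable_in_verts by fastforce
    show "refl_on (pverts G) {(x, y). x \<rightarrow>\<^sup>*\<^bsub>?S\<^esub> y}"
      by (rule refl_onI) (simp add: reachable_def)
    show "Relation.sym {(x, y). x \<rightarrow>\<^sup>*\<^bsub>?S\<^esub> y}"
      by (rule symI) (use symmetric_reachable[OF sym] in simp)
    show "trans {(x, y). x \<rightarrow>\<^sup>*\<^bsub>?S\<^esub> y}"
      by (rule transI) (use S.reachable_trans in blast)
  qed
qed

end

(* The key is that Gamma^2 is already very restricted. If Gamma is disconnected, then the diagonal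
   vertices over two different components of Gamma have no common neighbour in Gamma^2. Two
   non-adjacent vertices of Gamma^2 can be mapped to any two vertices by an endomorphism, so
   vertices of Gamma^2 with a common neighbour are equal or adjacent. If a -> b, b -> c and b -> c',
   then (b,c) and (b,c') have the common in-neighbour (a,b) and are not adjacent, so c = c'. Hence,
   if there is an arc at all, arcs are given by a successor function s; the end points of the path
   x, s x, s (s x) are adjacent, which forces s (s (s x)) = x. Conversely, having such a successor
   function is inherited by powers, and a homomorphism of induced subgraphs extends along the
   3-cycles that it meets. *)
theory Submission
  imports Defs
begin

section \<open>Isomorphisms and weak connectivity\<close>

text \<open>A library isomorphism has separate vertex, arc, tail and head maps. When arcs are pairs
  with the projections as ends, the vertex map \<open>f\<close> forces the arc map to be
  \<open>map_prod f f\<close>, so a single bijection carries all the information.\<close>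

lemma digraph_iso_with_proj_iff:
  "digraph_iso (with_proj G) (with_proj H) \<longleftrightarrow>
     pair_wf_digraph G \<and>
     (\<exists>f. bij_betw f (pverts G) (pverts H) \<and> parcs H = map_prod f f ` parcs G)"
proof
  assume "digraph_iso (with_proj G) (with_proj H)"
  then obtain h where h: "pre_digraph.digraph_isomorphism (with_proj G) h"
    and H: "with_proj H = app_iso h (with_proj G)"
    by (auto simp: digraph_iso_def)
  have tl: "iso_tail h = fst" and hd: "iso_head h = snd"
    and V: "pverts H = iso_verts h ` pverts G" and E: "parcs H = iso_arcs h ` parcs G"
    using arg_cong[OF H, of tail] arg_cong[OF H, of head]
      arg_cong[OF H, of verts] arg_cong[OF H, of arcs] by simp_all
  have "iso_arcs h a = map_prod (iso_verts h) (iso_verts h) a" if "a \<in> parcs G" for a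
    using h that by (auto simp: pre_digraph.digraph_isomorphism_def tl hd prod_eq_iff)
  then have "parcs H = map_prod (iso_verts h) (iso_verts h) ` parcs G"
    unfolding E by (rule image_cong[OF refl])
  moreover have "bij_betw (iso_verts h) (pverts G) (pverts H)"
    using h V by (simp add: pre_digraph.digraph_isomorphism_def bij_betw_def)
  moreover have "pair_wf_digraph G"
    using h by (simp add: pre_digraph.digraph_isomorphism_def wf_digraph_wp_iff)
  ultimately show "pair_wf_digraph G \<and>
     (\<exists>f. bij_betw f (pverts G) (pverts H) \<and> parcs H = map_prod f f ` parcs G)" by blast
next
  assume "pair_wf_digraph G \<and>
     (\<exists>f. bij_betw f (pverts G) (pverts H) \<and> parcs H = map_prod f f ` parcs G)"
  then obtain f where wf: "pair_wf_digraph G" and f: "bij_betw f (pverts G) (pverts H)"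
    and E: "parcs H = map_prod f f ` parcs G" by blast
  interpret pair_wf_digraph G by fact
  let ?h = "\<lparr>iso_verts = f, iso_arcs = map_prod f f, iso_head = snd, iso_tail = fst\<rparr>"
  have "inj_on (map_prod f f) (pverts G \<times> pverts G)"
    using f by (intro map_prod_inj_on) (auto simp: bij_betw_def)
  moreover have "parcs G \<subseteq> pverts G \<times> pverts G"
    using in_arcsD1 in_arcsD2 by auto
  ultimately have "inj_on (map_prod f f) (parcs G)"
    by (rule inj_on_subset)
  then have "pre_digraph.digraph_isomorphism (with_proj G) ?h"
    using f wf by (auto simp: pre_digraph.digraph_isomorphism_def wf_digraph_wp_iff bij_betw_def)
  moreover have "with_proj H = app_iso ?h (with_proj G)"
    using f E by (simp add: with_proj_def app_iso_def bij_betw_def)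
  ultimately show "digraph_iso (with_proj G) (with_proj H)"
    unfolding digraph_iso_def by blast
qed

definition adjacent :: "'a pair_pre_digraph \<Rightarrow> 'a \<Rightarrow> 'a \<Rightarrow> bool" where
  "adjacent G x y \<longleftrightarrow> (x, y) \<in> parcs G \<or> (y, x) \<in> parcs G"

lemma mk_symmetric_arc_iff [simp]:
  "(x, y) \<in> parcs (mk_symmetric (with_proj G)) \<longleftrightarrow> adjacent G x y"
  unfolding parcs_mk_symmetric adjacent_def with_proj_simps
  by (auto intro: bexI[of _ "(x, y)"] bexI[of _ "(y, x)"])

lemma disconnected_iff:
  assumes "oriented_graph G"
  shows "disconnected G \<longleftrightarrow> (\<exists>x \<in> pverts G. \<exists>y \<in> pverts G.
           \<not> x \<rightarrow>\<^sup>*\<^bsub>with_proj (mk_symmetric (with_proj G))\<^esub> y)"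
proof -
  let ?R = "{(x, y). x \<rightarrow>\<^sup>*\<^bsub>with_proj (mk_symmetric (with_proj G))\<^esub> y}"
  have "?R `` {x} \<noteq> ?R `` {y} \<longleftrightarrow> (x, y) \<notin> ?R" if "x \<in> pverts G" "y \<in> pverts G" for x y
    using eq_equiv_class_iff[OF equiv_weakly_connected[OF assms] that] by simp
  then show ?thesis
    unfolding disconnected_def weak_components_def quotient_def by simp
qed

text \<open>No arc crosses the boundary of \<open>S\<close>, so a walk in the symmetric closure that
  starts at \<open>x\<close> never leaves \<open>S\<close>.\<close>

lemma disconnectedI:
  assumes "oriented_graph G" "x \<in> pverts G" "y \<in> pverts G" "x \<in> S" "y \<notin> S"
    and closed: "\<And>u v. (u, v) \<in> parcs G \<Longrightarrow> u \<in> S \<longleftrightarrow> v \<in> S"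
  shows "disconnected G"
proof -
  interpret oriented_graph G by fact
  let ?S = "mk_symmetric (with_proj G)"
  interpret S: pair_wf_digraph ?S by (rule wellformed_mk_symmetric)
  have "v \<in> S" if "x \<rightarrow>\<^sup>*\<^bsub>with_proj ?S\<^esub> v" for v
    using that
  proof (induction rule: S.reachable_induct)
    case base
    show ?case by fact
  next
    case (step u v)
    then show ?case using closed by (auto simp: adjacent_def)
  qed
  then show ?thesis using assms disconnected_iff by blast
qed

text \<open>A common neighbour would give a walk of length two, so vertices of different components
  serve. The property passes to powers by projecting to a coordinate.\<close>

lemma disconnected_no_common_neighbour:
  assumes "oriented_graph G" "disconnected G"
  obtains u v where "u \<in> pverts G" "v \<in> pverts G" "\<And>z. \<not> (adjacent G u z \<and> adjacent G z v)"
proof -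
  interpret oriented_graph G by fact
  let ?S = "mk_symmetric (with_proj G)"
  interpret S: pair_wf_digraph ?S by (rule wellformed_mk_symmetric)
  obtain u v where uv: "u \<in> pverts G" "v \<in> pverts G" "\<not> u \<rightarrow>\<^sup>*\<^bsub>with_proj ?S\<^esub> v"
    using assms disconnected_iff by blast
  have "u \<rightarrow>\<^sup>*\<^bsub>with_proj ?S\<^esub> v" if "adjacent G u z" "adjacent G z v" for z
    using that S.reachable_adjI S.reachable_trans by (metis mk_symmetric_arc_iff)
  with uv that show thesis by blast
qed

section \<open>Homomorphism homogeneous graphs without common neighbours\<close>

text \<open>Applies homogeneity to a map on a finite vertex set: the subgraphs are those induced by
  \<open>A\<close> and by its image.\<close>

lemma homomorphism_homogeneous_extend:
  assumes "pair_wf_digraph G" "homomorphism_homogeneous G"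
    and "finite A" "A \<noteq> {}" "A \<subseteq> pverts G" "f ` A \<subseteq> pverts G"
    and "\<And>x y. x \<in> A \<Longrightarrow> y \<in> A \<Longrightarrow> (x, y) \<in> parcs G \<Longrightarrow> (f x, f y) \<in> parcs G"
  obtains g where "digraph_hom G G g" "\<And>x. x \<in> A \<Longrightarrow> g x = f x"
proof -
  define I where "I X = \<lparr>pverts = X, parcs = {e \<in> parcs G. fst e \<in> X \<and> snd e \<in> X}\<rparr>" for X
  have sub: "finite_induced_subgraph (I X) G" if "finite X" "X \<noteq> {}" "X \<subseteq> pverts G" for X
  proof -
    have "pair_wf_digraph (I X)" by unfold_locales (auto simp: I_def)
    then show ?thesis using that assms(1)
      by (auto simp: finite_induced_subgraph_def induced_subgraph_def subgraph_def
          wf_digraph_wp_iff I_def)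
  qed
  have "finite_induced_subgraph (I A) G" "finite_induced_subgraph (I (f ` A)) G"
    using assms by (auto intro!: sub)
  moreover have "digraph_hom (I A) (I (f ` A)) f"
    using assms(7) by (auto simp: digraph_hom_def I_def)
  moreover have "pverts (I A) = A" by (simp add: I_def)
  ultimately show thesis
    using assms(2) that unfolding homomorphism_homogeneous_def by metis
qed

lemma digraph_hom_arc: "digraph_hom G H g \<Longrightarrow> (x, y) \<in> parcs G \<Longrightarrow> (g x, g y) \<in> parcs H"
  by (auto simp: digraph_hom_def)

text \<open>Without loops, every map on a single vertex is a homomorphism. Extending the one that
  sends \<open>a\<close> (or \<open>b\<close>) to \<open>x\<close> carries the arc
  \<open>(a, b)\<close> to an arc out of (or into) \<open>x\<close>.\<close>

lemma homomorphism_homogeneous_in_out_neighbours: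
  assumes "oriented_graph G" "homomorphism_homogeneous G" "(a, b) \<in> parcs G" "x \<in> pverts G"
  shows "\<exists>y. (x, y) \<in> parcs G" "\<exists>y. (y, x) \<in> parcs G"
proof -
  interpret oriented_graph G by fact
  have wf: "pair_wf_digraph G" by unfold_locales
  have loopfree: "(u, u) \<notin> parcs G" for u
    using asym_arcs by (auto dest: asymD)
  have V: "a \<in> pverts G" "b \<in> pverts G"
    using assms(3) by (auto dest: in_arcsD1 in_arcsD2)
  have ex: "\<exists>g. digraph_hom G G g \<and> g c = x" if "c \<in> pverts G" for c
    by (rule homomorphism_homogeneous_extend[OF wf assms(2), of "{c}" "\<lambda>_. x"])
      (use that assms(4) loopfree in auto)
  show "\<exists>y. (x, y) \<in> parcs G" "\<exists>y. (y, x) \<in> parcs G"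
    using ex[OF V(1)] ex[OF V(2)] digraph_hom_arc assms(3) by metis+
qed

text \<open>If \<open>x\<close> and \<open>y\<close> are distinct and not adjacent, then sending
  them to \<open>u\<close> and \<open>v\<close> is a homomorphism, and its extension maps
  \<open>z\<close> to a forbidden common neighbour of \<open>u\<close> and \<open>v\<close>.\<close>

lemma common_neighbour_imp_adjacent:
  assumes "oriented_graph G" "homomorphism_homogeneous G"
    and uv: "u \<in> pverts G" "v \<in> pverts G" "\<And>z. \<not> (adjacent G u z \<and> adjacent G z v)"
    and xy: "adjacent G x z" "adjacent G z y"
  shows "x = y \<or> adjacent G x y"
proof (rule ccontr)
  assume nadj: "\<not> (x = y \<or> adjacent G x y)"
  interpret oriented_graph G by fact
  have wf: "pair_wf_digraph G" by unfold_locales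
  have loopfree: "(w, w) \<notin> parcs G" for w
    using asym_arcs by (auto dest: asymD)
  have V: "x \<in> pverts G" "y \<in> pverts G"
    using xy by (auto simp: adjacent_def dest: in_arcsD1 in_arcsD2)
  obtain g where "digraph_hom G G g" and g: "\<And>w. w \<in> {x, y} \<Longrightarrow> g w = (if w = x then u else v)"
    by (rule homomorphism_homogeneous_extend[OF wf assms(2),
          of "{x, y}" "\<lambda>w. if w = x then u else v"])
      (use V uv nadj loopfree in \<open>auto simp: adjacent_def\<close>)
  then have "adjacent G (g x) (g z)" "adjacent G (g z) (g y)"
    using xy by (auto simp: adjacent_def dest: digraph_hom_arc)
  then show False using uv(3) g nadj by auto
qed

section \<open>Disjoint unions of 3-cycles\<close>

text \<open>Describes a disjoint union of directed 3-cycles without naming its components: a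
  fixed-point-free map with trivial cube has orbits of size exactly three. Equations of this kind
  pass to powers coordinatewise.\<close>

definition three_cycle_successor :: "'a pair_pre_digraph \<Rightarrow> ('a \<Rightarrow> 'a) \<Rightarrow> bool" where
  "three_cycle_successor G s \<longleftrightarrow>
     (\<forall>x \<in> pverts G. s x \<in> pverts G \<and> s x \<noteq> x \<and> s (s (s x)) = x) \<and>
     parcs G = {(x, s x) | x. x \<in> pverts G}"

lemma three_cycle_successor_homomorphism_homogeneous:
  assumes s: "three_cycle_successor G s"
  shows "homomorphism_homogeneous G"
  unfolding homomorphism_homogeneous_def
proof (intro allI impI, elim conjE)
  fix A B f
  assume A: "finite_induced_subgraph A G" and B: "finite_induced_subgraph B G"
    and f: "digraph_hom A B f"
  define V where "V = pverts A"
  have V: "V \<subseteq> pverts G" "parcs A = {e \<in> parcs G. fst e \<in> V \<and> snd e \<in> V}"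
    using A by (auto simp: finite_induced_subgraph_def induced_subgraph_def subgraph_def V_def)
  have B': "pverts B \<subseteq> pverts G" "parcs B \<subseteq> parcs G"
    using B by (auto simp: finite_induced_subgraph_def induced_subgraph_def subgraph_def)
  have closed: "s x \<in> pverts G" "s x \<noteq> x" "s (s (s x)) = x" if "x \<in> pverts G" for x
    using s that by (auto simp: three_cycle_successor_def)
  have arcs: "parcs G = {(x, s x) | x. x \<in> pverts G}"
    using s by (simp add: three_cycle_successor_def)
  have fV: "f x \<in> pverts G" if "x \<in> V" for x
    using f B' that by (auto simp: digraph_hom_def V_def)
  have f_succ: "f (s x) = s (f x)" if "x \<in> V" "s x \<in> V" for x
  proof -
    have "(x, s x) \<in> parcs A" using that V arcs by auto
    then have "(f x, f (s x)) \<in> parcs G" using digraph_hom_arc[OF f] B' by blast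
    then show ?thesis using arcs by auto
  qed
  \<comment> \<open>An endomorphism must commute with \<open>s\<close>, so one value on a 3-cycle
    determines the others: the value at \<open>x\<close> is read off from the first of
    \<open>x\<close>, \<open>s x\<close>, \<open>s (s x)\<close> that lies in \<open>V\<close>.
    Cycles that miss \<open>V\<close> stay fixed.\<close>
  define g where "g x = (if x \<in> V then f x else if s x \<in> V then s (s (f (s x)))
      else if s (s x) \<in> V then s (f (s (s x))) else x)" for x
  have g_V: "g x \<in> pverts G" if "x \<in> pverts G" for x
    using that closed fV by (auto simp: g_def)
  have g_succ: "g (s x) = s (g x)" if x: "x \<in> pverts G" for x
  proof -
    have "s (s (s (f (s x)))) = f (s x)" if "s x \<in> V"
      using closed(3)[OF fV[OF that]] .
    then show ?thesis
      \<comment> \<open>The values \<open>g x\<close> and \<open>g (s x)\<close> stem from different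
        values of \<open>f\<close> only if \<open>x\<close> is in \<open>V\<close> together with
        \<open>s x\<close> or \<open>s (s x)\<close>; these are the two instances of
        \<open>f_succ\<close>.\<close>
      using f_succ[of x] f_succ[of "s (s x)"] by (simp add: g_def closed(3)[OF x])
  qed
  have "digraph_hom G G g"
    using g_V g_succ arcs by (auto simp: digraph_hom_def)
  moreover have "\<forall>x \<in> pverts A. g x = f x" by (simp add: g_def V_def)
  ultimately show "\<exists>g. digraph_hom G G g \<and> (\<forall>x \<in> pverts A. g x = f x)" by blast
qed

lemma three_cycle_successor_direct_power:
  assumes s: "three_cycle_successor G s" and n: "1 \<le> n"
  shows "three_cycle_successor (direct_power n G) (\<lambda>v. \<lambda>i\<in>{..<n}. s (v i))"
proof -
  let ?P = "{..<n} \<rightarrow>\<^sub>E pverts G" and ?s = "\<lambda>v. \<lambda>i\<in>{..<n}. s (v i)"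
  have closed: "s x \<in> pverts G" "s x \<noteq> x" "s (s (s x)) = x" if "x \<in> pverts G" for x
    using s that by (auto simp: three_cycle_successor_def)
  have arcs: "(x, y) \<in> parcs G \<longleftrightarrow> x \<in> pverts G \<and> y = s x" for x y
    using s by (auto simp: three_cycle_successor_def)
  have P: "?s v \<in> ?P" "?s v \<noteq> v" "?s (?s (?s v)) = v" if v: "v \<in> ?P" for v
  proof -
    show "?s v \<in> ?P" using v closed(1) by auto
    \<comment> \<open>Coordinate 0 exists because \<open>1 \<le> n\<close>.\<close>
    have "?s v 0 \<noteq> v 0" using v n closed(2)[of "v 0"] by (auto simp: PiE_iff)
    then show "?s v \<noteq> v" by metis
    show "?s (?s (?s v)) = v"
      by (rule extensionalityI[of _ "{..<n}"]) (use v closed in \<open>auto simp: PiE_iff\<close>)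
  qed
  have "v \<in> ?P \<and> w \<in> ?P \<and> (\<forall>i<n. (v i, w i) \<in> parcs G) \<longleftrightarrow> v \<in> ?P \<and> w = ?s v" for v w
  proof
    assume "v \<in> ?P \<and> w \<in> ?P \<and> (\<forall>i<n. (v i, w i) \<in> parcs G)"
    then have "v \<in> ?P" "w \<in> ?P" "\<forall>i<n. w i = s (v i)" using arcs by auto
    then show "v \<in> ?P \<and> w = ?s v"
      by (auto simp: PiE_iff intro!: extensionalityI[of _ "{..<n}"])
  next
    assume "v \<in> ?P \<and> w = ?s v"
    then show "v \<in> ?P \<and> w \<in> ?P \<and> (\<forall>i<n. (v i, w i) \<in> parcs G)"
      using P(1)[of v] arcs by (auto simp: PiE_iff)
  qed
  then show ?thesis
    using P by (auto simp: three_cycle_successor_def direct_power_def)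
qed

lemma three_cycle_successor_polymorphism_homogeneous:
  "three_cycle_successor G s \<Longrightarrow> polymorphism_homogeneous G"
  unfolding polymorphism_homogeneous_def
  by (intro allI impI)
    (rule three_cycle_successor_homomorphism_homogeneous[OF three_cycle_successor_direct_power])

section \<open>Graphs without arcs\<close>

lemma no_arcs_homomorphism_homogeneous:
  assumes "parcs G = {}"
  shows "homomorphism_homogeneous G"
  unfolding homomorphism_homogeneous_def
proof (intro allI impI, elim conjE)
  fix A B f
  assume "finite_induced_subgraph A G" and B: "finite_induced_subgraph B G"
    and f: "digraph_hom A B f"
  have "f x \<in> pverts G" if "x \<in> pverts A" for x
    using B f that by (auto simp: digraph_hom_def finite_induced_subgraph_def
        induced_subgraph_def subgraph_def)
  then have "digraph_hom G G (\<lambda>x. if x \<in> pverts A then f x else x)"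
    using assms by (simp add: digraph_hom_def)
  then show "\<exists>g. digraph_hom G G g \<and> (\<forall>x \<in> pverts A. g x = f x)"
    by (intro exI conjI) (assumption, simp)
qed

lemma no_arcs_polymorphism_homogeneous:
  assumes "parcs G = {}"
  shows "polymorphism_homogeneous G"
  unfolding polymorphism_homogeneous_def
proof (intro allI impI no_arcs_homomorphism_homogeneous)
  fix n :: nat assume "1 \<le> n"
  \<comment> \<open>With no coordinates the arc condition of the power would hold vacuously; one
    coordinate makes it unsatisfiable.\<close>
  then have "\<exists>i<n. True" by (intro exI[of _ 0]) simp
  then show "parcs (direct_power n G) = {}" by (simp add: direct_power_def assms)
qed

section \<open>The square of a disconnected polymorphism homogeneous graph\<close>

lemma polymorphism_homogeneous_disconnected_cases:
  assumes G: "oriented_graph G" and poly: "polymorphism_homogeneous G" and "disconnected G"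
  shows "parcs G = {} \<or> (\<exists>s. three_cycle_successor G s)"
proof (cases "parcs G = {}")
  case False
  then obtain a b where ab: "(a, b) \<in> parcs G" by auto
  interpret oriented_graph G by fact
  have asym: "(y, x) \<notin> parcs G" if "(x, y) \<in> parcs G" for x y
    using asym_arcs that by (rule asymD)
  define H where "H = direct_power 2 G"
  have H: "oriented_graph H" "homomorphism_homogeneous H"
    using oriented_graph_direct_power[OF G] poly
    by (simp_all add: H_def polymorphism_homogeneous_def)
  define pr where "pr x y = (\<lambda>i\<in>{..<2::nat}. if i = 0 then x else y)" for x y :: 'a
  have pr_0: "pr x y 0 = x" and pr_1: "pr x y (Suc 0) = y" for x y
    by (simp_all add: pr_def)
  have all_2: "(\<forall>i<2. P i) \<longleftrightarrow> P 0 \<and> P (Suc 0)" for P :: "nat \<Rightarrow> bool"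
    by (simp add: numeral_2_eq_2 All_less_Suc2)
  have pr_verts: "pr x y \<in> pverts H \<longleftrightarrow> x \<in> pverts G \<and> y \<in> pverts G" for x y
  proof -
    have "pr x y \<in> extensional {..<2}" by (simp add: pr_def)
    then show ?thesis
      by (simp add: H_def direct_power_def PiE_iff Ball_def all_2 pr_0 pr_1)
  qed
  have pr_arcs: "(pr x y, pr x' y') \<in> parcs H \<longleftrightarrow> (x, x') \<in> parcs G \<and> (y, y') \<in> parcs G"
    for x y x' y'
    using pr_verts[of x y] pr_verts[of x' y'] in_arcsD1 in_arcsD2
    by (auto simp: H_def direct_power_def all_2 pr_0 pr_1)
  have pr_eq: "pr x y = pr x' y' \<longleftrightarrow> x = x' \<and> y = y'" for x y x' y'
    by (metis pr_0 pr_1)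
  have arc_0: "(v 0, w 0) \<in> parcs G" if "(v, w) \<in> parcs H" for v w
    using that by (auto simp: H_def direct_power_def)
  obtain u v where uv: "u \<in> pverts G" "v \<in> pverts G"
    "\<And>z. \<not> (adjacent G u z \<and> adjacent G z v)"
    using disconnected_no_common_neighbour[OF G \<open>disconnected G\<close>] by metis
  have adj_0: "adjacent G (w 0) (z 0)" if "adjacent H w z" for w z
    using that arc_0 by (auto simp: adjacent_def)
  have "\<not> (adjacent H (pr u u) z \<and> adjacent H z (pr v v))" for z
    using uv(3)[of "z 0"] adj_0[of "pr u u" z] adj_0[of z "pr v v"] by (auto simp: pr_0)
  then have common: "w = z \<or> adjacent H w z" if "adjacent H w y" "adjacent H y z" for w y z
    using common_neighbour_imp_adjacent[OF H, of "pr u u" "pr v v"] uv that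
    by (auto simp: pr_verts)
  have out_nbr: "\<exists>y. (x, y) \<in> parcs G" and in_nbr: "\<exists>y. (y, x) \<in> parcs G"
    if "x \<in> pverts G" for x
  proof -
    \<comment> \<open>Homogeneity is at hand for the square, so neighbours of the diagonal vertex
      over \<open>x\<close> are found there and projected to coordinate 0.\<close>
    have "(pr a a, pr b b) \<in> parcs H" "pr x x \<in> pverts H"
      using ab that by (simp_all add: pr_arcs pr_verts)
    then obtain y z where "(pr x x, y) \<in> parcs H" "(z, pr x x) \<in> parcs H"
      using homomorphism_homogeneous_in_out_neighbours[OF H] by metis
    then show "\<exists>y. (x, y) \<in> parcs G" "\<exists>y. (y, x) \<in> parcs G"
      using arc_0 by (metis pr_0)+
  qed
  have unique: "c = c'" if xc: "(x, c) \<in> parcs G" "(x, c') \<in> parcs G" for x c c'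
  proof -
    obtain y where y: "(y, x) \<in> parcs G" using in_nbr[OF in_arcsD1[OF xc(1)]] ..
    \<comment> \<open>The common in-neighbour is \<open>pr y x\<close>. Adjacency is impossible,
      since the equal first coordinates would require a loop at \<open>x\<close>.\<close>
    have "pr x c = pr x c' \<or> adjacent H (pr x c) (pr x c')"
      using xc y by (intro common[of _ "pr y x"]) (auto simp: adjacent_def pr_arcs)
    then show ?thesis using asym by (auto simp: adjacent_def pr_arcs pr_eq)
  qed
  obtain s where s: "\<And>x. x \<in> pverts G \<Longrightarrow> (x, s x) \<in> parcs G"
    using out_nbr by metis
  have sV: "s x \<in> pverts G" if "x \<in> pverts G" for x
    using s[OF that] by (rule in_arcsD2)
  have cyc: "s (s (s x)) = x" if x: "x \<in> pverts G" for x
  proof -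
    have "(x, s x) \<in> parcs G" "(s x, s (s x)) \<in> parcs G" using s sV x by auto
    then have "pr x x = pr (s (s x)) (s (s x)) \<or> adjacent H (pr x x) (pr (s (s x)) (s (s x)))"
      by (intro common[of _ "pr (s x) (s x)"]) (auto simp: adjacent_def pr_arcs)
    then have "x = s (s x) \<or> (x, s (s x)) \<in> parcs G \<or> (s (s x), x) \<in> parcs G"
      by (auto simp: pr_eq pr_arcs adjacent_def)
    \<comment> \<open>\<open>x = s (s x)\<close> contradicts asymmetry. An arc from \<open>x\<close>
      to \<open>s (s x)\<close> would give \<open>s (s x) = s x\<close> by uniqueness, hence a loop.
      The remaining arc from \<open>s (s x)\<close> to \<open>x\<close> makes \<open>x\<close> the
      successor of \<open>s (s x)\<close>.\<close>
    then show ?thesis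
      using unique s sV x asym by metis
  qed
  have "(x, y) \<in> parcs G \<longleftrightarrow> x \<in> pverts G \<and> y = s x" for x y
    using s[of x] unique[of x y "s x"] in_arcsD1[of x y] by auto
  then have "parcs G = {(x, s x) | x. x \<in> pverts G}"
    by auto
  moreover have "s x \<noteq> x" if "x \<in> pverts G" for x
    using s[OF that] asym by metis
  ultimately have "three_cycle_successor G s"
    using sV cyc by (simp add: three_cycle_successor_def)
  then show ?thesis by blast
qed simp

section \<open>Copies of a graph\<close>

text \<open>Numbers the future copies: \<open>k\<close> is the cardinality of a finite
  \<open>Q\<close> and \<open>\<infinity>\<close> for an infinite one. The two distinct elements
  give \<open>1 < k\<close>.\<close>

lemma countable_enat_index:
  assumes "countable Q" "x \<in> Q" "y \<in> Q" "x \<noteq> y"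
  obtains k e where "1 < k" "bij_betw e {i. enat i < k} Q"
proof (cases "finite Q")
  case True
  obtain e where "bij_betw e {0..<card Q} Q"
    using ex_bij_betw_nat_finite[OF True] by blast
  moreover have "{0..<card Q} = {i. enat i < enat (card Q)}" by auto
  moreover have "card {x, y} \<le> card Q" using True assms by (intro card_mono) auto
  then have "1 < enat (card Q)" using assms by (simp add: one_enat_def)
  ultimately show thesis using that by metis
next
  case False
  have "bij_betw (from_nat_into Q) {i. enat i < \<infinity>} Q"
    using bij_betw_from_nat_into[OF assms(1) False] by simp
  then show thesis using that[of \<infinity>] by simp
qed

text \<open>Without arcs every bijection of vertex sets is an isomorphism, so an enumeration of the
  vertices suffices.\<close>

lemma iso_copies_I1:
  assumes G: "oriented_graph G" and "countable (pverts G)" "disconnected G" "parcs G = {}"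
  obtains k where "1 < k" "digraph_iso (with_proj G) (with_proj (copies k I1))"
proof -
  interpret oriented_graph G by fact
  have wf: "pair_wf_digraph G" by unfold_locales
  interpret S: pair_wf_digraph "mk_symmetric (with_proj G)" by (rule wellformed_mk_symmetric)
  obtain x y where xy: "x \<in> pverts G" "y \<in> pverts G" "x \<noteq> y"
    using \<open>disconnected G\<close> disconnected_iff[OF G] S.reachable_refl
    by (metis pverts_mk_symmetric with_proj_simps(1))
  obtain k e where k: "1 < k" "bij_betw e {i. enat i < k} (pverts G)"
    using countable_enat_index[OF assms(2) xy] .
  let ?f = "inv_into {i. enat i < k} e"
  have "bij_betw (\<lambda>x. (?f x, 0)) (pverts G) ({i. enat i < k} \<times> {0::nat})"
    using bij_betw_inv_into[OF k(2)] by (auto simp: bij_betw_def inj_on_def)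
  then have "digraph_iso (with_proj G) (with_proj (copies k I1))"
    using wf \<open>parcs G = {}\<close>
    by (auto simp: digraph_iso_with_proj_iff copies_def I1_def)
  with k that show thesis by blast
qed

text \<open>The orbits of \<open>s\<close> are the 3-cycles. They are enumerated, a representative
  \<open>r i\<close> is chosen in each, and vertex \<open>j\<close> of copy \<open>i\<close> goes to
  the \<open>j\<close>-th iterate of \<open>s\<close> at \<open>r i\<close>.\<close>

lemma iso_copies_C3:
  assumes G: "oriented_graph G" and "countable (pverts G)" "disconnected G"
    and succ: "three_cycle_successor G s"
  obtains k where "1 < k" "digraph_iso (with_proj G) (with_proj (copies k C3))"
proof -
  interpret oriented_graph G by fact
  have wf: "pair_wf_digraph G" by unfold_locales
  interpret S: pair_wf_digraph "mk_symmetric (with_proj G)" by (rule wellformed_mk_symmetric)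
  have s: "s x \<in> pverts G" "s x \<noteq> x" "s (s (s x)) = x" if "x \<in> pverts G" for x
    using succ that by (auto simp: three_cycle_successor_def)
  have arcs: "parcs G = {(x, s x) | x. x \<in> pverts G}"
    using succ by (simp add: three_cycle_successor_def)
  define orb where "orb x = {x, s x, s (s x)}" for x
  have orb_eq: "orb x = orb y" if "y \<in> orb x" "x \<in> pverts G" for x y
    using that s by (auto simp: orb_def)
  \<comment> \<open>Each vertex of an orbit is equal or adjacent to \<open>x\<close>, so an orbit
    lies in one component. Disconnectedness then yields the two distinct orbits behind
    \<open>1 < k\<close>.\<close>
  have "orb x \<noteq> orb y" if nr: "\<not> x \<rightarrow>\<^sup>*\<^bsub>with_proj (mk_symmetric (with_proj G))\<^esub> y"
    and x: "x \<in> pverts G" "y \<in> pverts G" for x y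
  proof
    assume "orb x = orb y"
    then have "y \<in> {x, s x, s (s x)}" by (auto simp: orb_def)
    moreover have "adjacent G x (s x)" "adjacent G x (s (s x))"
    proof -
      show "adjacent G x (s x)" using arcs x by (auto simp: adjacent_def)
      have "(s (s x), s (s (s x))) \<in> parcs G"
        using s(1)[OF s(1)[OF x(1)]] unfolding arcs by blast
      then show "adjacent G x (s (s x))" using s(3)[OF x(1)] by (simp add: adjacent_def)
    qed
    ultimately show False
      using nr x(1) S.reachable_adjI[of x] S.reachable_refl[of x] by auto
  qed
  then obtain x y where xy: "orb x \<in> orb ` pverts G" "orb y \<in> orb ` pverts G" "orb x \<noteq> orb y"
    using \<open>disconnected G\<close> disconnected_iff[OF G] by blast
  obtain k e where k: "1 < k" and e: "bij_betw e {i. enat i < k} (orb ` pverts G)"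
    using countable_enat_index[OF countable_image[OF assms(2)] xy] .
  have "\<forall>i. enat i < k \<longrightarrow> (\<exists>x \<in> pverts G. e i = orb x)"
    using bij_betwE[OF e] by auto
  then obtain r where r: "\<And>i. enat i < k \<Longrightarrow> r i \<in> pverts G" "\<And>i. enat i < k \<Longrightarrow> e i = orb (r i)"
    by metis
  define h where "h = (\<lambda>(i, j::nat). (if j = 0 then r i else if j = 1 then s (r i) else s (s (r i))))"
  have h_orb: "orb (h (i, j)) = e i" if "enat i < k" for i j
    using r[OF that] orb_eq[of "h (i, j)" "r i"] by (auto simp: h_def orb_def)
  let ?C = "copies k C3"
  have C: "pverts ?C = {i. enat i < k} \<times> {0, 1, 2}"
    by (simp add: copies_def C3_def)
  have CE: "parcs ?C = {((i, j), (i, j')) | i j j'. enat i < k \<and> (j, j') \<in> {(0, 1), (1, 2), (2, 0)}}"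
    by (simp add: copies_def C3_def)
  have inj: "inj_on h (pverts ?C)"
  proof (rule inj_onI)
    fix p q assume pq: "p \<in> pverts ?C" "q \<in> pverts ?C" "h p = h q"
    obtain i j i' j' where ij: "p = (i, j)" "q = (i', j')" by (cases p, cases q)
    have i: "enat i < k" "enat i' < k" and j: "j \<in> {0, 1, 2}" "j' \<in> {0, 1, 2}"
      using pq ij C by auto
    have "e i = e i'" using h_orb i pq ij by metis
    then have "i = i'" using e i by (auto simp: bij_betw_def dest: inj_onD)
    \<comment> \<open>The middle inequality uses the trivial cube: \<open>s (s (r i)) = r i\<close>
      would make \<open>r i\<close> a fixed point after one more application of
      \<open>s\<close>.\<close>
    moreover have "s (r i) \<noteq> r i" "s (s (r i)) \<noteq> r i" "s (s (r i)) \<noteq> s (r i)"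
      using r(1)[OF i(1)] s by metis+
    then have "j = j'" using pq(3) ij j \<open>i = i'\<close>
      by (auto simp: h_def)
    ultimately show "p = q" using ij by simp
  qed
  have "h ` pverts ?C = pverts G"
  proof
    show "h ` pverts ?C \<subseteq> pverts G"
      using r s by (auto simp: C h_def)
    show "pverts G \<subseteq> h ` pverts ?C"
    proof
      fix x assume x: "x \<in> pverts G"
      then have "orb x \<in> e ` {i. enat i < k}"
        using bij_betw_imp_surj_on[OF e] by blast
      then obtain i where i: "enat i < k" "orb x = e i" by blast
      then have "x \<in> orb (r i)" using r(2)[OF i(1)] by (auto simp: orb_def)
      then have "x = h (i, 0) \<or> x = h (i, 1) \<or> x = h (i, 2)" by (simp add: orb_def h_def)
      moreover have "(i, 0) \<in> pverts ?C" "(i, 1) \<in> pverts ?C" "(i, 2) \<in> pverts ?C"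
        using i by (simp_all add: C)
      ultimately show "x \<in> h ` pverts ?C" by blast
    qed
  qed
  with inj have h: "bij_betw h (pverts ?C) (pverts G)" by (simp add: bij_betw_def)
  have wfC: "pair_wf_digraph ?C" by unfold_locales (auto simp: C CE)
  have "parcs G = map_prod h h ` parcs ?C"
  proof
    show "map_prod h h ` parcs ?C \<subseteq> parcs G"
    proof
      fix a assume "a \<in> map_prod h h ` parcs ?C"
      then obtain i j j' where a: "a = (h (i, j), h (i, j'))" "enat i < k"
        and j: "(j, j') \<in> {(0, 1), (1, 2), (2, 0)}"
        unfolding CE by auto
      have "h (i, j') = s (h (i, j))" "h (i, j) \<in> pverts G"
        using j r(1)[OF a(2)] s by (auto simp: h_def)
      then show "a \<in> parcs G" using a by (auto simp: arcs)
    qed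
    show "parcs G \<subseteq> map_prod h h ` parcs ?C"
    proof
      fix a assume "a \<in> parcs G"
      then obtain x where x: "a = (x, s x)" "x \<in> pverts G" using arcs by auto
      have "x \<in> h ` ({i. enat i < k} \<times> {0, 1, 2})"
        using bij_betw_imp_surj_on[OF h] x(2) unfolding C by blast
      then obtain i j where ij: "x = h (i, j)" "enat i < k" "j \<in> {0, 1, 2}"
        by blast
      \<comment> \<open>The out-neighbour of \<open>j\<close> in \<open>C3\<close>; the wrap from 2
        to 0 matches \<open>s (s (s (r i))) = r i\<close>.\<close>
      let ?j = "if j = 0 then 1 else if j = 1 then 2 else 0"
      have "((i, j), (i, ?j)) \<in> parcs ?C" using ij by (auto simp: CE)
      moreover have "a = map_prod h h ((i, j), (i, ?j))"
        using x ij(1,3) s(3)[OF r(1)[OF ij(2)]] by (auto simp: h_def)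
      ultimately show "a \<in> map_prod h h ` parcs ?C" by blast
    qed
  qed
  then have "digraph_iso (with_proj ?C) (with_proj G)"
    using h wfC by (auto simp: digraph_iso_with_proj_iff)
  then have "digraph_iso (with_proj G) (with_proj ?C)"
    using wfC by (simp only: digraph_iso_swap[of "with_proj ?C"] wf_digraph_wp_iff)
  with k that show thesis by blast
qed

text \<open>All three properties are pulled back along the bijection \<open>f\<close>. For
  disconnectedness, copies 0 and 1 exist since \<open>1 < k\<close>, and the copy index is constant
  along arcs, so the preimage of copy 0 separates.\<close>

lemma iso_copies_properties:
  assumes iso: "digraph_iso (with_proj G) (with_proj (copies k H))"
    and H: "oriented_graph H" "countable (pverts H)" and k: "1 < k"
  shows "oriented_graph G" "countable (pverts G)" "disconnected G"
proof -
  let ?C = "copies k H"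
  obtain f where wf: "pair_wf_digraph G" and f: "bij_betw f (pverts G) (pverts ?C)"
    and E: "parcs ?C = map_prod f f ` parcs G"
    using iso by (auto simp: digraph_iso_with_proj_iff)
  have "0 < k" using k by (metis less_trans zero_less_one)
  then interpret C: oriented_graph ?C using oriented_graph_copies[OF H(1)] by blast
  interpret pair_wf_digraph G by fact
  have arcD: "(f u, f v) \<in> parcs ?C" if "(u, v) \<in> parcs G" for u v
    using that E by force
  show oG: "oriented_graph G"
  proof unfold_locales
    show "pverts G \<noteq> {}" using f C.verts_nonempty by (auto simp: bij_betw_def)
    show "asym (parcs G)" using arcD asymD[OF C.asym_arcs] by (blast intro: asymI)
  qed
  have "countable (pverts ?C)" using H(2) by (simp add: copies_def)
  then show "countable (pverts G)"
    using f by (metis bij_betw_def countable_image_inj_on)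
  obtain z where z: "z \<in> pverts H" using oriented_graph.verts_nonempty[OF H(1)] by blast
  have "(0, z) \<in> pverts ?C" "(1, z) \<in> pverts ?C"
    using z k \<open>0 < k\<close> by (simp_all add: copies_def zero_enat_def one_enat_def)
  then obtain x y where xy: "x \<in> pverts G" "y \<in> pverts G" "f x = (0, z)" "f y = (1, z)"
    using bij_betw_imp_surj_on[OF f] by (metis imageE)
  show "disconnected G"
  proof (rule disconnectedI[OF oG xy(1,2), of "{u. fst (f u) = 0}"])
    fix u v assume "(u, v) \<in> parcs G"
    then have "fst (f u) = fst (f v)" using arcD[of u v] by (auto simp: copies_def)
    then show "u \<in> {u. fst (f u) = 0} \<longleftrightarrow> v \<in> {u. fst (f u) = 0}" by simp
  qed (use xy in auto)
qed

text \<open>The rotation \<open>t\<close> of every copy of \<open>C3\<close> is a successor function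
  on the copies; conjugating it by the isomorphism gives \<open>s\<close>.\<close>

lemma iso_copies_C3_successor:
  assumes "digraph_iso (with_proj G) (with_proj (copies k C3))"
  obtains s where "three_cycle_successor G s"
proof -
  let ?C = "copies k C3"
  obtain f where wf: "pair_wf_digraph G" and f: "bij_betw f (pverts G) (pverts ?C)"
    and E: "parcs ?C = map_prod f f ` parcs G"
    using assms by (auto simp: digraph_iso_with_proj_iff)
  interpret pair_wf_digraph G by fact
  define t where "t = (\<lambda>(i::nat, j::nat). (i, if j = 0 then 1 else if j = 1 then 2 else 0::nat))"
  have t: "t p \<in> pverts ?C" "t p \<noteq> p" "t (t (t p)) = p" if "p \<in> pverts ?C" for p
    using that by (auto simp: copies_def C3_def t_def)
  have arcs: "(p, q) \<in> parcs ?C \<longleftrightarrow> p \<in> pverts ?C \<and> q = t p" for p q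
    by (cases p; cases q) (auto simp: copies_def C3_def t_def)
  let ?g = "inv_into (pverts G) f"
  define s where "s x = ?g (t (f x))" for x
  have fV: "f x \<in> pverts ?C" if "x \<in> pverts G" for x
    using f that by (auto simp: bij_betw_def)
  have fg: "f (?g p) = p" "?g p \<in> pverts G" if "p \<in> pverts ?C" for p
    using that f by (auto simp: bij_betw_def f_inv_into_f inv_into_into)
  have gf: "?g (f x) = x" if "x \<in> pverts G" for x
    using that f by (auto simp: bij_betw_def)
  have sV: "s x \<in> pverts G" and fs: "f (s x) = t (f x)" if "x \<in> pverts G" for x
    using that fg t fV by (auto simp: s_def)
  have "s x \<noteq> x" "s (s (s x)) = x" if x: "x \<in> pverts G" for x
  proof -
    show "s x \<noteq> x" using fs[OF x] t(2)[OF fV[OF x]] by metis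
    have "f (s (s (s x))) = f x" using fs sV x t(3)[OF fV[OF x]] by metis
    then show "s (s (s x)) = x" using gf sV x by metis
  qed
  moreover have "(x, y) \<in> parcs G \<longleftrightarrow> x \<in> pverts G \<and> y = s x" for x y
  proof
    assume xy: "(x, y) \<in> parcs G"
    then have "(f x, f y) \<in> parcs ?C" using E by force
    then have "f y = t (f x)" using arcs by blast
    then show "x \<in> pverts G \<and> y = s x"
      using gf in_arcsD1[OF xy] in_arcsD2[OF xy] by (metis s_def)
  next
    assume x: "x \<in> pverts G \<and> y = s x"
    then have "(f x, f y) \<in> parcs ?C" using arcs fV fs by auto
    then obtain x' y' where "(x', y') \<in> parcs G" "f x' = f x" "f y' = f y" using E by auto
    moreover from this have "x' = x" "y' = y"
      using gf x sV in_arcsD1 in_arcsD2 by metis+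
    ultimately show "(x, y) \<in> parcs G" by simp
  qed
  ultimately have "three_cycle_successor G s"
    using sV by (auto simp: three_cycle_successor_def)
  then show thesis by (rule that)
qed

theorem theorem5p3:
  fixes G :: "'a pair_pre_digraph"
  shows "oriented_graph G \<and> countable (pverts G) \<and> polymorphism_homogeneous G \<and> disconnected G
    \<longleftrightarrow> (\<exists>k::enat. 1 < k \<and> k \<le> \<infinity> \<and>
          (digraph_iso (with_proj G) (with_proj (copies k I1)) \<or>
           digraph_iso (with_proj G) (with_proj (copies k C3))))"
proof
  assume "oriented_graph G \<and> countable (pverts G) \<and> polymorphism_homogeneous G \<and> disconnected G"
  then show "\<exists>k::enat. 1 < k \<and> k \<le> \<infinity> \<and>
          (digraph_iso (with_proj G) (with_proj (copies k I1)) \<or>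
           digraph_iso (with_proj G) (with_proj (copies k C3)))"
    using polymorphism_homogeneous_disconnected_cases[of G] iso_copies_I1[of G] iso_copies_C3[of G]
    by (metis enat_ord_code(3))
next
  assume "\<exists>k::enat. 1 < k \<and> k \<le> \<infinity> \<and>
          (digraph_iso (with_proj G) (with_proj (copies k I1)) \<or>
           digraph_iso (with_proj G) (with_proj (copies k C3)))"
  then obtain k :: enat where k: "1 < k"
    and "digraph_iso (with_proj G) (with_proj (copies k I1)) \<or>
         digraph_iso (with_proj G) (with_proj (copies k C3))" by blast
  then show "oriented_graph G \<and> countable (pverts G) \<and> polymorphism_homogeneous G \<and> disconnected G"
  proof (elim disjE)
    assume iso: "digraph_iso (with_proj G) (with_proj (copies k I1))"
    have "countable (pverts I1)" by (simp add: I1_def)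
    note props = iso_copies_properties[OF iso oriented_graph_I1 this k]
    have "parcs G = {}"
      using iso by (auto simp: digraph_iso_with_proj_iff copies_def I1_def)
    then show ?thesis using props no_arcs_polymorphism_homogeneous by blast
  next
    assume iso: "digraph_iso (with_proj G) (with_proj (copies k C3))"
    have "countable (pverts C3)" by (simp add: C3_def)
    note props = iso_copies_properties[OF iso oriented_graph_C3 this k]
    then show ?thesis
      using iso_copies_C3_successor[OF iso] three_cycle_successor_polymorphism_homogeneous by metis
  qed
qed

end
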